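(* Let $\mathcal{V}$ be a variety of universal algebras, and let $\mathcal{C}$ be the variety of universal algebras obtained from $\mathcal{V}$ by adding a commutative semigroup structure, with operation written $\cdot$, such that for all $A$ in $\mathcal{C}$ and all $a\in A$ the map $a\cdot(-):A\to A$ is a morphism in $\mathcal{V}$. Let $A$ be an algebra in $\mathcal{C}$. The space $\mathrm{Spec}(\mathrm{Id}(A))$ is spectral whenever $A$ is a finitely generated ideal of itself.
   Context: For $A$ in $\mathcal{C}$, an ideal of $A$ is a subalgebra $x$ of $A$ such that $a\in A$ and $s\in x$ imply $a\cdot s\in x$. Subalgebras are allowed to be empty when there are no nullary operations. The set $\mathrm{Id}(A)$ of all ideals of $A$, ordered by inclusion, is a complete lattice whose meets are intersections; it is a complete multiplicative lattice under $xy=\langle x\cdot y\rangle$, where $x\cdot y=\{s\cdot t\mid s\in x,\ t\in y\}$ and $\langle S\rangle$ denotes the $\mathcal{V}$-subalgebra of $A$ generated by $S$. "$A$ is a finitely generated ideal of itself" means that there is a finite subset of $A$ such that the smallest ideal of $A$ containing it is $A$. A complete multiplicative lattice is a complete lattice $L$ with a binary multiplication satisfying $xy\leqslant x\wedge y$ for all $x,y\in L$. An element $p\neq 1$ of $L$ (where $1$ is the largest element) is prime if for all $x,y\in L$, $xy\leqslant p$ implies $x\leqslant p$ or $y\leqslant p$. $\mathrm{Spec}(L)$ is the set of prime elements of $L$ with the Zariski topology, whose closed sets are exactly the sets $\mathrm{V}(x)=\{p\in\mathrm{Spec}(L)\mid x\leqslant p\}$, $x\in L$. A spectral space is a compact sober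 topological space in which the compact open subsets form a basis of the topology that is closed under finite intersections; sober means $\mathrm{T}_0$ and every irreducible closed subset is the closure of a one-element set. *)

theory Defs
  imports "HOL-Algebra.Complete_Lattice" "HOL-Analysis.Abstract_Topological_Spaces"
begin

section \<open>Universal algebras and varieties\<close>

text \<open>
  The operation symbols form a subset of the type \<open>'f\<close>, not the whole type, so that the empty
  signature is covered as well.
\<close>

record 'f signature =
  symbols :: "'f set"
  arity :: "'f \<Rightarrow> nat"

record ('f, 'a) alg = "'a partial_object" +
  interp :: "'f \<Rightarrow> 'a list \<Rightarrow> 'a"

definition universal_algebra :: "('f, 's) signature_scheme \<Rightarrow> ('f, 'a, 'm) alg_scheme \<Rightarrow> bool" where
  "universal_algebra \<Sigma> A \<longleftrightarrow>
     (\<forall>f\<in>symbols \<Sigma>. \<forall>as. set as \<subseteq> carrier A \<and> length as = arity \<Sigma> f \<longrightarrow>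
        interp A f as \<in> carrier A)"

definition alg_hom ::
    "('f, 's) signature_scheme \<Rightarrow> ('f, 'a, 'm) alg_scheme \<Rightarrow> ('f, 'b, 'n) alg_scheme \<Rightarrow> ('a \<Rightarrow> 'b) \<Rightarrow> bool" where
  "alg_hom \<Sigma> A B h \<longleftrightarrow>
     (\<forall>a\<in>carrier A. h a \<in> carrier B) \<and>
     (\<forall>f\<in>symbols \<Sigma>. \<forall>as. set as \<subseteq> carrier A \<and> length as = arity \<Sigma> f \<longrightarrow>
        h (interp A f as) = interp B f (map h as))"

definition subalgebra :: "('f, 's) signature_scheme \<Rightarrow> ('f, 'a, 'm) alg_scheme \<Rightarrow> 'a set \<Rightarrow> bool" where
  "subalgebra \<Sigma> A x \<longleftrightarrow> x \<subseteq> carrier A \<and>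
     (\<forall>f\<in>symbols \<Sigma>. \<forall>as. set as \<subseteq> x \<and> length as = arity \<Sigma> f \<longrightarrow> interp A f as \<in> x)"

definition generated :: "('f, 's) signature_scheme \<Rightarrow> ('f, 'a, 'm) alg_scheme \<Rightarrow> 'a set \<Rightarrow> 'a set" where
  "generated \<Sigma> A S = \<Inter>{x. subalgebra \<Sigma> A x \<and> S \<subseteq> x}"

text \<open>
  Since operations are finitary, each identity involves finitely many variables, so that
  variables indexed by \<open>nat\<close> suffice.
\<close>

datatype 'f trm = Var nat | App 'f "'f trm list"

primrec wf_trm :: "('f, 's) signature_scheme \<Rightarrow> 'f trm \<Rightarrow> bool" where
  "wf_trm \<Sigma> (Var i) \<longleftrightarrow> True"
| "wf_trm \<Sigma> (App f ts) \<longleftrightarrow>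
     f \<in> symbols \<Sigma> \<and> length ts = arity \<Sigma> f \<and> list_all id (map (wf_trm \<Sigma>) ts)"

primrec trm_val :: "('f, 'a, 'm) alg_scheme \<Rightarrow> (nat \<Rightarrow> 'a) \<Rightarrow> 'f trm \<Rightarrow> 'a" where
  "trm_val A \<rho> (Var i) = \<rho> i"
| "trm_val A \<rho> (App f ts) = interp A f (map (trm_val A \<rho>) ts)"

definition satisfies :: "('f, 'a, 'm) alg_scheme \<Rightarrow> 'f trm \<times> 'f trm \<Rightarrow> bool" where
  "satisfies A e \<longleftrightarrow>
     (\<forall>\<rho>. (\<forall>i. \<rho> i \<in> carrier A) \<longrightarrow> trm_val A \<rho> (fst e) = trm_val A \<rho> (snd e))"

definition identities :: "('f, 's) signature_scheme \<Rightarrow> ('f trm \<times> 'f trm) set" where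
  "identities \<Sigma> = {(s, t). wf_trm \<Sigma> s \<and> wf_trm \<Sigma> t}"

text \<open>
  A variety \<open>\<V>\<close> is presented by its signature \<open>\<Sigma>\<close> and a set \<open>E\<close> of identities over \<open>\<Sigma>\<close>.
  Algebras may be empty if there are no nullary operations.
\<close>

definition in_variety ::
    "('f, 's) signature_scheme \<Rightarrow> ('f trm \<times> 'f trm) set \<Rightarrow> ('f, 'a, 'm) alg_scheme \<Rightarrow> bool" where
  "in_variety \<Sigma> E A \<longleftrightarrow> universal_algebra \<Sigma> A \<and> (\<forall>e\<in>E. satisfies A e)"


section \<open>Adding a commutative semigroup structure\<close>

record ('f, 'a) dot_alg = "('f, 'a) alg" +
  dot :: "'a \<Rightarrow> 'a \<Rightarrow> 'a" (infixl \<open>\<cdot>\<index>\<close> 70)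

definition comm_semigroup_on :: "'a set \<Rightarrow> ('a \<Rightarrow> 'a \<Rightarrow> 'a) \<Rightarrow> bool" where
  "comm_semigroup_on S m \<longleftrightarrow>
     (\<forall>a\<in>S. \<forall>b\<in>S. m a b \<in> S) \<and>
     (\<forall>a\<in>S. \<forall>b\<in>S. \<forall>c\<in>S. m (m a b) c = m a (m b c)) \<and>
     (\<forall>a\<in>S. \<forall>b\<in>S. m a b = m b a)"

text \<open>Membership in the variety \<open>\<C>\<close> obtained from the variety \<open>\<V>\<close> presented by \<open>\<Sigma>\<close> and \<open>E\<close>.\<close>

definition in_dot_variety ::
    "('f, 's) signature_scheme \<Rightarrow> ('f trm \<times> 'f trm) set \<Rightarrow> ('f, 'a, 'm) dot_alg_scheme \<Rightarrow> bool" where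
  "in_dot_variety \<Sigma> E A \<longleftrightarrow>
     in_variety \<Sigma> E A \<and>
     comm_semigroup_on (carrier A) (dot A) \<and>
     (\<forall>a\<in>carrier A. alg_hom \<Sigma> A A (dot A a))"

definition dot_subalgebra :: "('f, 's) signature_scheme \<Rightarrow> ('f, 'a, 'm) dot_alg_scheme \<Rightarrow> 'a set \<Rightarrow> bool" where
  "dot_subalgebra \<Sigma> A x \<longleftrightarrow> subalgebra \<Sigma> A x \<and> (\<forall>s\<in>x. \<forall>t\<in>x. s \<cdot>\<^bsub>A\<^esub> t \<in> x)"

definition alg_ideal :: "('f, 's) signature_scheme \<Rightarrow> ('f, 'a, 'm) dot_alg_scheme \<Rightarrow> 'a set \<Rightarrow> bool" where
  "alg_ideal \<Sigma> A x \<longleftrightarrow>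
     dot_subalgebra \<Sigma> A x \<and> (\<forall>a\<in>carrier A. \<forall>s\<in>x. a \<cdot>\<^bsub>A\<^esub> s \<in> x)"

definition ideal_generated ::
    "('f, 's) signature_scheme \<Rightarrow> ('f, 'a, 'm) dot_alg_scheme \<Rightarrow> 'a set \<Rightarrow> 'a set" where
  "ideal_generated \<Sigma> A S = \<Inter>{x. alg_ideal \<Sigma> A x \<and> S \<subseteq> x}"

definition fin_gen_ideal_of_itself ::
    "('f, 's) signature_scheme \<Rightarrow> ('f, 'a, 'm) dot_alg_scheme \<Rightarrow> bool" where
  "fin_gen_ideal_of_itself \<Sigma> A \<longleftrightarrow>
     (\<exists>S. finite S \<and> S \<subseteq> carrier A \<and> ideal_generated \<Sigma> A S = carrier A)"


section \<open>Complete multiplicative lattices and their spectra\<close>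

text \<open>The multiplication is not assumed to be associative, commutative or monotone.\<close>

record 'a mult_order = "'a gorder" +
  lprod :: "'a \<Rightarrow> 'a \<Rightarrow> 'a" (infixl \<open>\<odot>\<index>\<close> 70)

locale complete_multiplicative_lattice = complete_lattice L
  for L :: "('a, 'm) mult_order_scheme" (structure) +
  assumes lprod_closed: "\<lbrakk>x \<in> carrier L; y \<in> carrier L\<rbrakk> \<Longrightarrow> x \<odot> y \<in> carrier L"
    and lprod_le_meet: "\<lbrakk>x \<in> carrier L; y \<in> carrier L\<rbrakk> \<Longrightarrow> x \<odot> y \<sqsubseteq> x \<sqinter> y"

definition prime_element :: "('a, 'm) mult_order_scheme \<Rightarrow> 'a \<Rightarrow> bool" where
  "prime_element L p \<longleftrightarrow> p \<in> carrier L \<and> p \<noteq> \<top>\<^bsub>L\<^esub> \<and>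
     (\<forall>x\<in>carrier L. \<forall>y\<in>carrier L. x \<odot>\<^bsub>L\<^esub> y \<sqsubseteq>\<^bsub>L\<^esub> p \<longrightarrow> x \<sqsubseteq>\<^bsub>L\<^esub> p \<or> y \<sqsubseteq>\<^bsub>L\<^esub> p)"

definition Spec :: "('a, 'm) mult_order_scheme \<Rightarrow> 'a set" where
  "Spec L = {p. prime_element L p}"

definition zariski_closed :: "('a, 'm) mult_order_scheme \<Rightarrow> 'a \<Rightarrow> 'a set" where
  "zariski_closed L x = {p \<in> Spec L. x \<sqsubseteq>\<^bsub>L\<^esub> p}"

definition zariski_topology :: "('a, 'm) mult_order_scheme \<Rightarrow> 'a topology" where
  "zariski_topology L = topology (\<lambda>U. \<exists>x\<in>carrier L. U = Spec L - zariski_closed L x)"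

context complete_multiplicative_lattice
begin

lemma zariski_closed_lprod:
  assumes "x \<in> carrier L" "y \<in> carrier L"
  shows "zariski_closed L (x \<odot> y) = zariski_closed L x \<union> zariski_closed L y"
proof -
  note xy = lprod_closed[OF assms]
  have "x \<odot> y \<sqsubseteq> x" "x \<odot> y \<sqsubseteq> y"
    using le_trans[OF lprod_le_meet[OF assms] meet_left[OF assms] xy _ assms(1)]
      le_trans[OF lprod_le_meet[OF assms] meet_right[OF assms] xy _ assms(2)]
      meet_closed[OF assms] by auto
  then have le: "x \<odot> y \<sqsubseteq> p" if "p \<in> carrier L" "x \<sqsubseteq> p \<or> y \<sqsubseteq> p" for p
    using that le_trans[OF _ _ xy assms(1) that(1)] le_trans[OF _ _ xy assms(2) that(1)] by blast
  have "x \<odot> y \<sqsubseteq> p \<longleftrightarrow> x \<sqsubseteq> p \<or> y \<sqsubseteq> p" if "prime_element L p" for p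
    using that le[of p] assms unfolding prime_element_def by blast
  then show ?thesis
    unfolding zariski_closed_def Spec_def by auto
qed

lemma zariski_closed_Sup:
  assumes "X \<subseteq> carrier L"
  shows "zariski_closed L (\<Squnion>X) = {p \<in> Spec L. \<forall>x\<in>X. x \<sqsubseteq> p}"
proof -
  have "\<Squnion>X \<sqsubseteq> p \<longleftrightarrow> (\<forall>x\<in>X. x \<sqsubseteq> p)" if "p \<in> carrier L" for p
  proof
    assume "\<Squnion>X \<sqsubseteq> p"
    then show "\<forall>x\<in>X. x \<sqsubseteq> p"
      using le_trans[OF sup_upper[OF assms]] assms sup_closed[OF assms] that by blast
  next
    assume "\<forall>x\<in>X. x \<sqsubseteq> p"
    with that show "\<Squnion>X \<sqsubseteq> p" by (intro sup_least[OF assms]) auto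
  qed
  then show ?thesis
    unfolding zariski_closed_def Spec_def by (auto simp: prime_element_def)
qed

lemma istopology_zariski:
  "istopology (\<lambda>U. \<exists>x\<in>carrier L. U = Spec L - zariski_closed L x)"
  unfolding istopology_def
proof (intro conjI allI impI)
  fix U V
  assume "\<exists>x\<in>carrier L. U = Spec L - zariski_closed L x"
    and "\<exists>x\<in>carrier L. V = Spec L - zariski_closed L x"
  then obtain x y where xy: "x \<in> carrier L" "U = Spec L - zariski_closed L x"
    "y \<in> carrier L" "V = Spec L - zariski_closed L y"
    by blast
  have "U \<inter> V = Spec L - zariski_closed L (x \<odot> y)"
    using xy zariski_closed_lprod by auto
  then show "\<exists>x\<in>carrier L. U \<inter> V = Spec L - zariski_closed L x"
    using xy lprod_closed by blast
next
  fix \<U>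
  assume *: "\<forall>U\<in>\<U>. \<exists>x\<in>carrier L. U = Spec L - zariski_closed L x"
  define X where "X = {x \<in> carrier L. Spec L - zariski_closed L x \<in> \<U>}"
  have X: "X \<subseteq> carrier L" by (auto simp: X_def)
  have "\<Union>\<U> = (\<Union>x\<in>X. Spec L - zariski_closed L x)"
  proof (intro equalityI subsetI)
    fix p assume "p \<in> \<Union>\<U>"
    then obtain U where U: "U \<in> \<U>" "p \<in> U" by blast
    with * obtain x where "x \<in> carrier L" "U = Spec L - zariski_closed L x" by blast
    with U show "p \<in> (\<Union>x\<in>X. Spec L - zariski_closed L x)" by (auto simp: X_def)
  qed (auto simp: X_def)
  also have "\<dots> = Spec L - zariski_closed L (\<Squnion>X)"
    unfolding zariski_closed_Sup[OF X] by (auto simp: zariski_closed_def)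
  finally show "\<exists>x\<in>carrier L. \<Union>\<U> = Spec L - zariski_closed L x"
    using sup_closed[OF X] by blast
qed

lemma openin_zariski:
  "openin (zariski_topology L) U \<longleftrightarrow> (\<exists>x\<in>carrier L. U = Spec L - zariski_closed L x)"
  unfolding zariski_topology_def using istopology_zariski by (simp add: topology_inverse')

lemma topspace_zariski: "topspace (zariski_topology L) = Spec L"
proof -
  have "zariski_closed L \<top> = {}"
    unfolding zariski_closed_def Spec_def prime_element_def
    using top_closed top_higher le_antisym by blast
  then have "openin (zariski_topology L) (Spec L)"
    unfolding openin_zariski using top_closed by (metis Diff_empty)
  then show ?thesis
    using openin_subset[of "zariski_topology L" "Spec L"] openin_topspace[of "zariski_topology L"]
    unfolding openin_zariski[of "topspace _"] by auto
qed

lemma closedin_zariski: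
  "closedin (zariski_topology L) C \<longleftrightarrow> (\<exists>x\<in>carrier L. C = zariski_closed L x)"
proof -
  have "zariski_closed L x \<subseteq> Spec L" for x
    by (auto simp: zariski_closed_def)
  then show ?thesis
    unfolding closedin_def openin_zariski topspace_zariski by (metis double_diff subset_refl Diff_subset)
qed

end


section \<open>The multiplicative lattice of ideals\<close>

definition Id_lattice ::
    "('f, 's) signature_scheme \<Rightarrow> ('f, 'a, 'm) dot_alg_scheme \<Rightarrow> 'a set mult_order" where
  "Id_lattice \<Sigma> A =
     \<lparr>carrier = {x. alg_ideal \<Sigma> A x}, eq = (=), le = (\<subseteq>),
      lprod = (\<lambda>x y. generated \<Sigma> A {s \<cdot>\<^bsub>A\<^esub> t | s t. s \<in> x \<and> t \<in> y})\<rparr>"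

lemma alg_ideal_carrier:
  assumes "in_dot_variety \<Sigma> E A"
  shows "alg_ideal \<Sigma> A (carrier A)"
  using assms
  unfolding in_dot_variety_def in_variety_def universal_algebra_def comm_semigroup_on_def
    alg_ideal_def dot_subalgebra_def subalgebra_def
  by auto

lemma alg_ideal_Inter:
  assumes "in_dot_variety \<Sigma> E A" and "\<forall>x\<in>X. alg_ideal \<Sigma> A x"
  shows "alg_ideal \<Sigma> A (carrier A \<inter> \<Inter>X)"
proof -
  have "alg_ideal \<Sigma> A (\<Inter>(insert (carrier A) X))"
    using assms alg_ideal_carrier[OF assms(1)]
    unfolding alg_ideal_def dot_subalgebra_def subalgebra_def by (simp add: le_Inf_iff)
  then show ?thesis by simp
qed

lemma alg_ideal_product:
  assumes A: "in_dot_variety \<Sigma> E A" and x: "alg_ideal \<Sigma> A x" and y: "alg_ideal \<Sigma> A y"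
  defines "P \<equiv> {s \<cdot>\<^bsub>A\<^esub> t | s t. s \<in> x \<and> t \<in> y}"
  shows "alg_ideal \<Sigma> A (generated \<Sigma> A P)" and "generated \<Sigma> A P \<subseteq> x \<inter> y"
proof -
  let ?G = "generated \<Sigma> A P"
  have xc: "x \<subseteq> carrier A" and yc: "y \<subseteq> carrier A"
    using x y by (auto simp: alg_ideal_def dot_subalgebra_def subalgebra_def)
  have closed: "\<And>a b. a \<in> carrier A \<Longrightarrow> b \<in> carrier A \<Longrightarrow> a \<cdot>\<^bsub>A\<^esub> b \<in> carrier A"
    and assoc: "\<And>a b c. a \<in> carrier A \<Longrightarrow> b \<in> carrier A \<Longrightarrow> c \<in> carrier A \<Longrightarrow>
        a \<cdot>\<^bsub>A\<^esub> b \<cdot>\<^bsub>A\<^esub> c = a \<cdot>\<^bsub>A\<^esub> (b \<cdot>\<^bsub>A\<^esub> c)"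
    and comm: "\<And>a b. a \<in> carrier A \<Longrightarrow> b \<in> carrier A \<Longrightarrow> a \<cdot>\<^bsub>A\<^esub> b = b \<cdot>\<^bsub>A\<^esub> a"
    and hom: "\<And>a. a \<in> carrier A \<Longrightarrow> alg_hom \<Sigma> A A (dot A a)"
    and UA: "universal_algebra \<Sigma> A"
    using A by (auto simp: in_dot_variety_def in_variety_def comm_semigroup_on_def)
  have ideal: "a \<cdot>\<^bsub>A\<^esub> s \<in> x" if "a \<in> carrier A" "s \<in> x" for a s
    using x that by (auto simp: alg_ideal_def)
  have idealy: "a \<cdot>\<^bsub>A\<^esub> s \<in> y" if "a \<in> carrier A" "s \<in> y" for a s
    using y that by (auto simp: alg_ideal_def)
  have Pxy: "P \<subseteq> x \<inter> y"
  proof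
    fix p assume "p \<in> P"
    then obtain s t where st: "p = s \<cdot>\<^bsub>A\<^esub> t" "s \<in> x" "t \<in> y" by (auto simp: P_def)
    then have "s \<in> carrier A" "t \<in> carrier A" using xc yc by auto
    with st show "p \<in> x \<inter> y" using ideal[of t s] idealy[of s t] comm[of s t] by auto
  qed
  have GI: "?G \<subseteq> z" if "subalgebra \<Sigma> A z" "P \<subseteq> z" for z
    using that by (auto simp: generated_def)
  show sub: "?G \<subseteq> x \<inter> y"
    using GI[of x] GI[of y] x y Pxy by (auto simp: alg_ideal_def dot_subalgebra_def)
  have PG: "P \<subseteq> ?G" by (auto simp: generated_def)
  have subG: "subalgebra \<Sigma> A ?G"
    unfolding subalgebra_def
  proof (intro conjI ballI allI impI)
    show "?G \<subseteq> carrier A" using sub xc by auto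
  next
    fix f as
    assume f: "f \<in> symbols \<Sigma>" and as: "set as \<subseteq> ?G \<and> length as = arity \<Sigma> f"
    show "interp A f as \<in> ?G"
      unfolding generated_def
    proof (rule InterI, clarify)
      fix z assume z: "subalgebra \<Sigma> A z" "P \<subseteq> z"
      with as GI[OF z] have "set as \<subseteq> z" by auto
      with z f as show "interp A f as \<in> z" by (auto simp: subalgebra_def)
    qed
  qed
  have abs: "a \<cdot>\<^bsub>A\<^esub> g \<in> ?G" if a: "a \<in> carrier A" and g: "g \<in> ?G" for a g
  proof -
    let ?z = "{g \<in> carrier A. a \<cdot>\<^bsub>A\<^esub> g \<in> ?G}"
    have "subalgebra \<Sigma> A ?z"
      unfolding subalgebra_def
    proof (intro conjI ballI allI impI)
      fix f as
      assume f: "f \<in> symbols \<Sigma>" and as: "set as \<subseteq> ?z \<and> length as = arity \<Sigma> f"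
      then have asc: "set as \<subseteq> carrier A" by auto
      have 1: "interp A f as \<in> carrier A"
        using UA f as asc by (auto simp: universal_algebra_def)
      have "a \<cdot>\<^bsub>A\<^esub> interp A f as = interp A f (map (dot A a) as)"
        using hom[OF a] f as asc by (auto simp: alg_hom_def)
      also have "\<dots> \<in> ?G"
      proof -
        have "set (map (dot A a) as) \<subseteq> ?G" using as by auto
        with subG f as show ?thesis unfolding subalgebra_def by (metis length_map)
      qed
      finally show "interp A f as \<in> ?z" using 1 by auto
    qed auto
    moreover have "P \<subseteq> ?z"
    proof
      fix p assume "p \<in> P"
      then obtain s t where st: "p = s \<cdot>\<^bsub>A\<^esub> t" "s \<in> x" "t \<in> y" by (auto simp: P_def)
      have "a \<cdot>\<^bsub>A\<^esub> p = (a \<cdot>\<^bsub>A\<^esub> s) \<cdot>\<^bsub>A\<^esub> t"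
        using assoc[of a s t] a st subsetD[OF xc] subsetD[OF yc] by simp
      then have "a \<cdot>\<^bsub>A\<^esub> p \<in> P" using ideal[OF a st(2)] st(3) by (auto simp: P_def)
      then show "p \<in> ?z" using PG \<open>p \<in> P\<close> Pxy xc by auto
    qed
    ultimately show ?thesis using GI g by blast
  qed
  show "alg_ideal \<Sigma> A ?G"
    unfolding alg_ideal_def dot_subalgebra_def
    using subG abs by (auto simp: subalgebra_def)
qed

lemma complete_lattice_Id_lattice:
  assumes "in_dot_variety \<Sigma> E A"
  shows "complete_lattice (Id_lattice \<Sigma> A)"
proof -
  let ?L = "Id_lattice \<Sigma> A"
  interpret partial_order ?L
    by unfold_locales (auto simp: Id_lattice_def)
  have inf: "\<exists>i. greatest ?L i (Lower ?L X)" if "X \<subseteq> carrier ?L" for X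
  proof (rule exI[of _ "carrier A \<inter> \<Inter>X"])
    have "alg_ideal \<Sigma> A (carrier A \<inter> \<Inter>X)"
      using alg_ideal_Inter[OF assms] that by (auto simp: Id_lattice_def)
    moreover have "x \<subseteq> carrier A" if "alg_ideal \<Sigma> A x" for x
      using that by (auto simp: alg_ideal_def dot_subalgebra_def subalgebra_def)
    ultimately show "greatest ?L (carrier A \<inter> \<Inter>X) (Lower ?L X)"
      using that unfolding greatest_def Lower_def Id_lattice_def by simp blast
  qed
  show ?thesis
  proof (rule complete_lattice_criterion1)
    show "\<exists>g. greatest ?L g (carrier ?L)"
      using alg_ideal_carrier[OF assms]
      by (intro exI[of _ "carrier A"])
        (auto simp: greatest_def Id_lattice_def alg_ideal_def dot_subalgebra_def subalgebra_def)
  qed (use inf in blast)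
qed

theorem complete_multiplicative_lattice_Id_lattice:
  assumes "in_dot_variety \<Sigma> E A"
  shows "complete_multiplicative_lattice (Id_lattice \<Sigma> A)"
proof -
  let ?L = "Id_lattice \<Sigma> A"
  interpret complete_lattice ?L by (rule complete_lattice_Id_lattice[OF assms])
  show ?thesis
  proof
    fix x y assume xy: "x \<in> carrier ?L" "y \<in> carrier ?L"
    then have P: "x \<odot>\<^bsub>?L\<^esub> y \<in> carrier ?L" "x \<odot>\<^bsub>?L\<^esub> y \<subseteq> x" "x \<odot>\<^bsub>?L\<^esub> y \<subseteq> y"
      using alg_ideal_product[OF assms, of x y] by (auto simp: Id_lattice_def)
    then show "x \<odot>\<^bsub>?L\<^esub> y \<in> carrier ?L" by simp
    show "x \<odot>\<^bsub>?L\<^esub> y \<sqsubseteq>\<^bsub>?L\<^esub> x \<sqinter>\<^bsub>?L\<^esub> y"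
      by (rule meet_le) (use P xy in \<open>auto simp: Id_lattice_def\<close>)
  qed
qed


section \<open>Spectral spaces\<close>

definition irreducible_closed :: "'a topology \<Rightarrow> 'a set \<Rightarrow> bool" where
  "irreducible_closed X C \<longleftrightarrow> closedin X C \<and> C \<noteq> {} \<and>
     (\<forall>C1 C2. closedin X C1 \<and> closedin X C2 \<and> C = C1 \<union> C2 \<longrightarrow> C = C1 \<or> C = C2)"

definition sober_space :: "'a topology \<Rightarrow> bool" where
  "sober_space X \<longleftrightarrow> t0_space X \<and>
     (\<forall>C. irreducible_closed X C \<longrightarrow> (\<exists>a\<in>topspace X. C = X closure_of {a}))"

definition compact_open :: "'a topology \<Rightarrow> 'a set \<Rightarrow> bool" where
  "compact_open X U \<longleftrightarrow> openin X U \<and> compactin X U"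

text \<open>
  The intersection with \<open>topspace X\<close> only matters for the empty family, whose intersection is
  the whole space.
\<close>

definition spectral_space :: "'a topology \<Rightarrow> bool" where
  "spectral_space X \<longleftrightarrow> compact_space X \<and> sober_space X \<and>
     openin X = arbitrary union_of (compact_open X) \<and>
     (\<forall>\<U>. finite \<U> \<and> (\<forall>U\<in>\<U>. compact_open X U) \<longrightarrow> compact_open X (topspace X \<inter> \<Inter>\<U>))"

end

theory Submission
  imports Defs
begin

text \<open>
  Since multiplication by an element is a morphism, \<open>{g. b \<cdot> g \<in> x}\<close> is an ideal for every
  ideal \<open>x\<close>. Hence an ideal is a prime element of \<open>Id(A)\<close> exactly if it is prime on elements, and,
  by Zorn's lemma, every ideal disjoint from a nonempty multiplicatively closed set lies in a
  prime disjoint from it. The sets \<open>D(a) = {p. a \<notin> p}\<close> form a base with \<open>D(a) \<inter> D(b) = D(a \<cdot> b)\<close>.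
  They are compact: if \<open>D(a) \<subseteq> \<Union>s\<in>x. D(s)\<close> for an ideal \<open>x\<close>, then \<open>x\<close> meets the multiplicatively closed set
  \<open>{m. D(a) \<subseteq> D(m)}\<close>, and as the operations are finitary, a common element already lies in an ideal
  generated by finitely many of the given generators of \<open>x\<close>. A finite set generating \<open>A\<close> as an
  ideal covers the spectrum by finitely many sets \<open>D(a)\<close>. The generic point of an irreducible closed set is
  its intersection.
\<close>

section \<open>Recognising spectral spaces from a base of compact open sets\<close>

lemma spectral_spaceI:
  assumes "compact_space X" "sober_space X"
    and B: "\<And>U. U \<in> \<B> \<Longrightarrow> compact_open X U"
    and Int: "\<And>U V. U \<in> \<B> \<Longrightarrow> V \<in> \<B> \<Longrightarrow> U \<inter> V \<in> \<B>"
    and base: "\<And>U. openin X U \<Longrightarrow> \<exists>\<U>\<subseteq>\<B>. U = \<Union>\<U>"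
  shows "spectral_space X"
proof -
  have open_iff: "openin X U \<longleftrightarrow> (arbitrary union_of compact_open X) U" for U
  proof
    assume "openin X U"
    with base obtain \<U> where "\<U> \<subseteq> \<B>" "U = \<Union>\<U>" by blast
    with B show "(arbitrary union_of compact_open X) U"
      unfolding union_of_def arbitrary_def by blast
  next
    assume "(arbitrary union_of compact_open X) U"
    then obtain \<U> where "\<U> \<subseteq> Collect (compact_open X)" and U: "U = \<Union>\<U>"
      by (auto simp: union_of_def arbitrary_def)
    then show "openin X U" unfolding U by (intro openin_Union) (auto simp: compact_open_def)
  qed
  \<comment> \<open>Applied to a cover by base members, compactness makes every compact open set a
    finite union of them. This reduces intersections of arbitrary compact open sets to those of base
    members.\<close>
  have finite_base: "\<exists>\<F>. finite \<F> \<and> \<F> \<subseteq> \<B> \<and> U = \<Union>\<F>" if U: "compact_open X U" for U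
  proof -
    from U base obtain \<U> where \<U>: "\<U> \<subseteq> \<B>" "U = \<Union>\<U>" by (auto simp: compact_open_def)
    with B have "\<forall>V\<in>\<U>. openin X V" by (auto simp: compact_open_def)
    with U \<U>(2) obtain \<F> where "finite \<F>" "\<F> \<subseteq> \<U>" "U \<subseteq> \<Union>\<F>"
      unfolding compact_open_def compactin_def by (metis order_refl)
    with \<U> show ?thesis by (intro exI[of _ \<F>]) auto
  qed
  have Int2: "compact_open X (U \<inter> V)" if UV: "compact_open X U" "compact_open X V" for U V
  proof -
    obtain \<F> where F: "finite \<F>" "\<F> \<subseteq> \<B>" "U = \<Union>\<F>" using finite_base[OF UV(1)] by blast
    obtain \<G> where G: "finite \<G>" "\<G> \<subseteq> \<B>" "V = \<Union>\<G>" using finite_base[OF UV(2)] by blast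
    have "U \<inter> V = \<Union>((\<lambda>(u, v). u \<inter> v) ` (\<F> \<times> \<G>))" using F G by auto
    moreover have "compactin X (\<Union>((\<lambda>(u, v). u \<inter> v) ` (\<F> \<times> \<G>)))"
    proof (rule compactin_Union)
      fix W assume "W \<in> (\<lambda>(u, v). u \<inter> v) ` (\<F> \<times> \<G>)"
      then have "W \<in> \<B>" using F(2) G(2) Int by auto
      with B show "compactin X W" by (simp add: compact_open_def)
    qed (use F G in auto)
    moreover have "openin X (U \<inter> V)" using UV by (auto simp: compact_open_def)
    ultimately show ?thesis by (simp add: compact_open_def)
  qed
  have "compact_open X (topspace X \<inter> \<Inter>\<U>)"
    if "finite \<U>" "\<forall>U\<in>\<U>. compact_open X U" for \<U>
    using that
  proof (induction \<U>)
    \<comment> \<open>The empty intersection is the whole space, so this case is the compactness of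
      \<open>X\<close>.\<close>
    case empty
    with assms(1) show ?case by (simp add: compact_open_def compact_space_def)
  next
    case (insert U \<U>)
    then have "compact_open X (U \<inter> (topspace X \<inter> \<Inter>\<U>))"
      using Int2[of U "topspace X \<inter> \<Inter>\<U>"] by simp
    moreover have "topspace X \<inter> \<Inter>(insert U \<U>) = U \<inter> (topspace X \<inter> \<Inter>\<U>)" by auto
    ultimately show ?case by simp
  qed
  with assms(1,2) open_iff show ?thesis by (auto simp: spectral_space_def)
qed

section \<open>Ideals and generated ideals\<close>

locale dot_algebra =
  fixes \<Sigma> :: "('f, 's) signature_scheme"
    and E :: "('f trm \<times> 'f trm) set"
    and A :: "('f, 'a, 'm) dot_alg_scheme"
  assumes in_dot_variety: "in_dot_variety \<Sigma> E A"
begin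

lemmas Id_lattice = complete_multiplicative_lattice_Id_lattice[OF in_dot_variety]

abbreviation ideal where "ideal \<equiv> alg_ideal \<Sigma> A"
abbreviation gen where "gen \<equiv> ideal_generated \<Sigma> A"
abbreviation mult (infixl \<open>\<star>\<close> 70) where "a \<star> b \<equiv> a \<cdot>\<^bsub>A\<^esub> b"
abbreviation Primes where "Primes \<equiv> Spec (Id_lattice \<Sigma> A)"
abbreviation Zariski where "Zariski \<equiv> zariski_topology (Id_lattice \<Sigma> A)"

lemma mult_closed: "a \<in> carrier A \<Longrightarrow> b \<in> carrier A \<Longrightarrow> a \<star> b \<in> carrier A"
  and mult_assoc: "a \<in> carrier A \<Longrightarrow> b \<in> carrier A \<Longrightarrow> c \<in> carrier A \<Longrightarrow> a \<star> b \<star> c = a \<star> (b \<star> c)"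
  and mult_comm: "a \<in> carrier A \<Longrightarrow> b \<in> carrier A \<Longrightarrow> a \<star> b = b \<star> a"
  and mult_hom: "a \<in> carrier A \<Longrightarrow> alg_hom \<Sigma> A A (dot A a)"
  using in_dot_variety by (auto simp: in_dot_variety_def comm_semigroup_on_def)

lemma interp_closed:
  "f \<in> symbols \<Sigma> \<Longrightarrow> set as \<subseteq> carrier A \<Longrightarrow> length as = arity \<Sigma> f \<Longrightarrow> interp A f as \<in> carrier A"
  using in_dot_variety by (auto simp: in_dot_variety_def in_variety_def universal_algebra_def)

lemma ideal_subset: "ideal x \<Longrightarrow> x \<subseteq> carrier A"
  and ideal_mult: "ideal x \<Longrightarrow> a \<in> carrier A \<Longrightarrow> s \<in> x \<Longrightarrow> a \<star> s \<in> x"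
  and ideal_interp:
    "ideal x \<Longrightarrow> f \<in> symbols \<Sigma> \<Longrightarrow> set as \<subseteq> x \<Longrightarrow> length as = arity \<Sigma> f \<Longrightarrow> interp A f as \<in> x"
  and ideal_subalgebra: "ideal x \<Longrightarrow> subalgebra \<Sigma> A x"
  by (auto simp: alg_ideal_def dot_subalgebra_def subalgebra_def)

lemma ideal_mult': "ideal x \<Longrightarrow> a \<in> carrier A \<Longrightarrow> s \<in> x \<Longrightarrow> s \<star> a \<in> x"
  using ideal_mult[of x a s] ideal_subset[of x] mult_comm[of a s] by (simp add: subset_iff)

lemma idealI:
  assumes "x \<subseteq> carrier A"
    and "\<And>f as. f \<in> symbols \<Sigma> \<Longrightarrow> set as \<subseteq> x \<Longrightarrow> length as = arity \<Sigma> f \<Longrightarrow> interp A f as \<in> x"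
    and "\<And>a s. a \<in> carrier A \<Longrightarrow> s \<in> x \<Longrightarrow> a \<star> s \<in> x"
  shows "ideal x"
  using assms by (auto simp: alg_ideal_def dot_subalgebra_def subalgebra_def)

text \<open>Closure under the operations holds because \<open>b \<star> (-)\<close> is a morphism,
  and absorption because \<open>b \<star> (a \<star> s) = a \<star> (b \<star> s)\<close>. Thus a
  condition \<open>b \<star> g \<in> x\<close> holds on a generated ideal as soon as it holds on the
  generators.\<close>

lemma ideal_colon:
  assumes x: "ideal x" and b: "b \<in> carrier A"
  shows "ideal {g \<in> carrier A. b \<star> g \<in> x}"
proof (rule idealI)
  fix f as
  assume f: "f \<in> symbols \<Sigma>" "set as \<subseteq> {g \<in> carrier A. b \<star> g \<in> x}" "length as = arity \<Sigma> f"
  then have "interp A f (map (dot A b) as) \<in> x" by (intro ideal_interp[OF x]) auto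
  moreover have "b \<star> interp A f as = interp A f (map (dot A b) as)"
  proof -
    have "set as \<subseteq> carrier A" using f(2) by auto
    with mult_hom[OF b] f show ?thesis by (simp add: alg_hom_def)
  qed
  ultimately show "interp A f as \<in> {g \<in> carrier A. b \<star> g \<in> x}"
    using f interp_closed[of f as] by auto
next
  fix a s assume a: "a \<in> carrier A" and s: "s \<in> {g \<in> carrier A. b \<star> g \<in> x}"
  then have "b \<star> (a \<star> s) = a \<star> (b \<star> s)"
    using b mult_assoc[of b a s] mult_assoc[of a b s] mult_comm[of a b] by simp
  with a s show "a \<star> s \<in> {g \<in> carrier A. b \<star> g \<in> x}"
    using ideal_mult[OF x, of a "b \<star> s"] mult_closed[of a s] by simp
qed auto

text \<open>The finitely many arguments of an operation lie in a common member of the family. For a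
  constant the argument list is empty, and \<open>ne\<close> supplies the member.\<close>

lemma ideal_directed_Union:
  assumes ne: "X \<noteq> {}" and ideals: "\<And>x. x \<in> X \<Longrightarrow> ideal x"
    and dir: "\<And>x y. x \<in> X \<Longrightarrow> y \<in> X \<Longrightarrow> \<exists>z\<in>X. x \<union> y \<subseteq> z"
  shows "ideal (\<Union>X)"
proof (rule idealI)
  have fin: "\<exists>z\<in>X. F \<subseteq> z" if "finite F" "F \<subseteq> \<Union>X" for F
    using that
  proof (induction F)
    case (insert a F)
    then obtain x y where xy: "x \<in> X" "y \<in> X" "F \<subseteq> x" "a \<in> y" by auto
    with dir[of x y] show ?case by blast
  qed (use ne in auto)
  fix f as assume f: "f \<in> symbols \<Sigma>" "set as \<subseteq> \<Union>X" "length as = arity \<Sigma> f"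
  with fin[of "set as"] obtain z where "z \<in> X" "set as \<subseteq> z" by auto
  with f ideals ideal_interp show "interp A f as \<in> \<Union>X" by blast
next
  fix a s assume "a \<in> carrier A" "s \<in> \<Union>X"
  with ideals ideal_mult show "a \<star> s \<in> \<Union>X" by blast
qed (use ideals ideal_subset in blast)

lemma ideal_gen:
  assumes "S \<subseteq> carrier A"
  shows "ideal (gen S)"
proof -
  \<comment> \<open>The carrier is itself an ideal containing \<open>S\<close>, so intersecting with
    it changes nothing; \<open>alg_ideal_Inter\<close> has this form to allow empty
    families.\<close>
  have "ideal (carrier A \<inter> \<Inter>{x. ideal x \<and> S \<subseteq> x})"
    by (rule alg_ideal_Inter[OF in_dot_variety]) auto
  moreover have "carrier A \<inter> \<Inter>{x. ideal x \<and> S \<subseteq> x} = gen S"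
    using alg_ideal_carrier[OF in_dot_variety] assms by (auto simp: ideal_generated_def)
  ultimately show ?thesis by simp
qed

lemma subset_gen: "S \<subseteq> gen S"
  by (auto simp: ideal_generated_def)

lemma gen_least: "ideal x \<Longrightarrow> S \<subseteq> x \<Longrightarrow> gen S \<subseteq> x"
  by (auto simp: ideal_generated_def)

lemma gen_mono: "S \<subseteq> T \<Longrightarrow> gen S \<subseteq> gen T"
  by (auto simp: ideal_generated_def)

text \<open>The ideals generated by finite subsets of \<open>S\<close> form a directed family, so
  their union is an ideal; it contains \<open>S\<close> and hence \<open>gen S\<close>.\<close>

lemma gen_finite:
  assumes S: "S \<subseteq> carrier A" and a: "a \<in> gen S"
  shows "\<exists>F. finite F \<and> F \<subseteq> S \<and> a \<in> gen F"
proof -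
  let ?X = "gen ` {F. finite F \<and> F \<subseteq> S}"
  have "ideal (\<Union>?X)"
  proof (rule ideal_directed_Union)
    fix x y assume "x \<in> ?X" "y \<in> ?X"
    then obtain F G where FG: "finite F" "F \<subseteq> S" "x = gen F" "finite G" "G \<subseteq> S" "y = gen G" by auto
    then have "gen (F \<union> G) \<in> ?X" by auto
    moreover have "x \<union> y \<subseteq> gen (F \<union> G)" using FG gen_mono[of _ "F \<union> G"] by simp
    ultimately show "\<exists>z\<in>?X. x \<union> y \<subseteq> z" by blast
  qed (use S ideal_gen in auto)
  moreover have "S \<subseteq> \<Union>?X"
  proof
    fix s assume "s \<in> S"
    then have "gen {s} \<in> ?X" "s \<in> gen {s}" using subset_gen[of "{s}"] by auto
    then show "s \<in> \<Union>?X" by blast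
  qed
  ultimately have "gen S \<subseteq> \<Union>?X" by (rule gen_least)
  with a show ?thesis by auto
qed

text \<open>Colon ideals are used twice: first with a generator \<open>s'\<close> fixed, to pass
  from \<open>T\<close> to \<open>gen T\<close>, then with \<open>t\<close> fixed, to pass from
  \<open>S\<close> to \<open>gen S\<close>. Commutativity swaps the factors in between.\<close>

lemma gen_mult:
  assumes x: "ideal x" and S: "S \<subseteq> carrier A" and T: "T \<subseteq> carrier A"
    and ST: "\<And>s t. s \<in> S \<Longrightarrow> t \<in> T \<Longrightarrow> s \<star> t \<in> x"
    and s: "s \<in> gen S" and t: "t \<in> gen T"
  shows "s \<star> t \<in> x"
proof -
  have 1: "s' \<star> t \<in> x" if s': "s' \<in> S" for s'
  proof -
    have "gen T \<subseteq> {g \<in> carrier A. s' \<star> g \<in> x}"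
      by (rule gen_least[OF ideal_colon[OF x]]) (use s' S T ST in auto)
    with t show ?thesis by auto
  qed
  have tc: "t \<in> carrier A" using t ideal_subset[OF ideal_gen[OF T]] by blast
  have "gen S \<subseteq> {g \<in> carrier A. t \<star> g \<in> x}"
    by (rule gen_least[OF ideal_colon[OF x tc]]) (use S 1 tc mult_comm in auto)
  with s have "s \<in> carrier A" "t \<star> s \<in> x" by auto
  with tc show ?thesis using mult_comm[of s t] by simp
qed

section \<open>Prime ideals and their existence\<close>

lemma top_Id_lattice: "\<top>\<^bsub>Id_lattice \<Sigma> A\<^esub> = carrier A"
proof -
  interpret complete_lattice "Id_lattice \<Sigma> A"
    by (rule complete_lattice_Id_lattice[OF in_dot_variety])
  show ?thesis
    using top_closed top_higher[of "carrier A"] alg_ideal_carrier[OF in_dot_variety]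
    by (auto simp: Id_lattice_def dest: ideal_subset)
qed

text \<open>As \<open>p\<close> is a subalgebra, the product of two ideals lies in \<open>p\<close>
  iff all products of their elements do. From ideals to elements one takes \<open>gen {a}\<close>
  and \<open>gen {b}\<close> and applies \<open>gen_mult\<close>; conversely, two ideals not
  contained in \<open>p\<close> have elements outside \<open>p\<close> whose product is outside
  \<open>p\<close>.\<close>

lemma Spec_Id_lattice_iff:
  "p \<in> Primes \<longleftrightarrow> ideal p \<and> p \<noteq> carrier A \<and>
     (\<forall>a\<in>carrier A. \<forall>b\<in>carrier A. a \<star> b \<in> p \<longrightarrow> a \<in> p \<or> b \<in> p)"
proof -
  have prod_le: "x \<odot>\<^bsub>Id_lattice \<Sigma> A\<^esub> y \<subseteq> p \<longleftrightarrow> (\<forall>s\<in>x. \<forall>t\<in>y. s \<star> t \<in> p)" if "ideal p" for x y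
    using ideal_subalgebra[OF that] by (auto simp: Id_lattice_def generated_def)
  have "(\<forall>x y. ideal x \<longrightarrow> ideal y \<longrightarrow> (\<forall>s\<in>x. \<forall>t\<in>y. s \<star> t \<in> p) \<longrightarrow> x \<subseteq> p \<or> y \<subseteq> p) \<longleftrightarrow>
        (\<forall>a\<in>carrier A. \<forall>b\<in>carrier A. a \<star> b \<in> p \<longrightarrow> a \<in> p \<or> b \<in> p)" (is "?l \<longleftrightarrow> ?r")
    if p: "ideal p"
  proof
    assume l: ?l
    show ?r
    proof (intro ballI impI)
      fix a b assume ab: "a \<in> carrier A" "b \<in> carrier A" "a \<star> b \<in> p"
      have "\<forall>s\<in>gen {a}. \<forall>t\<in>gen {b}. s \<star> t \<in> p"
        using gen_mult[OF p, of "{a}" "{b}"] ab by auto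
      with l have "gen {a} \<subseteq> p \<or> gen {b} \<subseteq> p" using ideal_gen[of "{a}"] ideal_gen[of "{b}"] ab by auto
      then show "a \<in> p \<or> b \<in> p" using subset_gen[of "{a}"] subset_gen[of "{b}"] by auto
    qed
  next
    assume ?r
    then show ?l using ideal_subset by blast
  qed
  moreover have "p \<in> Primes \<longleftrightarrow> ideal p \<and> p \<noteq> carrier A \<and>
      (\<forall>x y. ideal x \<longrightarrow> ideal y \<longrightarrow> (\<forall>s\<in>x. \<forall>t\<in>y. s \<star> t \<in> p) \<longrightarrow> x \<subseteq> p \<or> y \<subseteq> p)"
  proof -
    have "p \<in> Primes \<longleftrightarrow> ideal p \<and> p \<noteq> carrier A \<and>
        (\<forall>x y. ideal x \<longrightarrow> ideal y \<longrightarrow> x \<odot>\<^bsub>Id_lattice \<Sigma> A\<^esub> y \<subseteq> p \<longrightarrow> x \<subseteq> p \<or> y \<subseteq> p)"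
      unfolding Spec_def prime_element_def top_Id_lattice by (simp add: Id_lattice_def)
    then show ?thesis using prod_le by (simp cong: conj_cong)
  qed
  ultimately show ?thesis by (simp cong: conj_cong)
qed

lemma exists_prime_disjoint:
  assumes x: "ideal x" and M: "M \<subseteq> carrier A" "M \<noteq> {}"
    and Mmult: "\<And>a b. a \<in> M \<Longrightarrow> b \<in> M \<Longrightarrow> a \<star> b \<in> M"
    and disj: "x \<inter> M = {}"
  shows "\<exists>p\<in>Primes. x \<subseteq> p \<and> p \<inter> M = {}"
proof -
  let ?Q = "{q. ideal q \<and> x \<subseteq> q \<and> q \<inter> M = {}}"
  have "\<exists>q\<in>?Q. \<forall>y\<in>?Q. q \<subseteq> y \<longrightarrow> y = q"
  proof (rule subset_Zorn_nonempty)
    show "?Q \<noteq> {}" using x disj by auto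
  next
    fix \<C> assume C: "\<C> \<noteq> {}" "subset.chain ?Q \<C>"
    have "ideal (\<Union>\<C>)"
    proof (rule ideal_directed_Union[OF C(1)])
      fix y z assume "y \<in> \<C>" "z \<in> \<C>"
      with C(2) have "y \<subseteq> z \<or> z \<subseteq> y" by (auto simp: subset_chain_def)
      with \<open>y \<in> \<C>\<close> \<open>z \<in> \<C>\<close> show "\<exists>w\<in>\<C>. y \<union> z \<subseteq> w" by (metis Un_absorb1 Un_absorb2 order_refl)
    qed (use C(2) in \<open>auto simp: subset_chain_def\<close>)
    then show "\<Union>\<C> \<in> ?Q" using C by (auto simp: subset_chain_def)
  qed
  then obtain q where q: "ideal q" "x \<subseteq> q" "q \<inter> M = {}"
    and max: "\<And>y. ideal y \<Longrightarrow> q \<subseteq> y \<Longrightarrow> y \<inter> M = {} \<Longrightarrow> y = q"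
    by auto
  \<comment> \<open>By maximality, enlarging \<open>q\<close> by any new element produces an ideal
    that meets \<open>M\<close>.\<close>
  have meets: "\<exists>m\<in>M. m \<in> gen (insert a q)" if "a \<in> carrier A" "a \<notin> q" for a
    using max[of "gen (insert a q)"] ideal_gen[of "insert a q"] subset_gen[of "insert a q"]
      ideal_subset[OF q(1)] that by blast
  have "a \<in> q \<or> b \<in> q" if ab: "a \<in> carrier A" "b \<in> carrier A" "a \<star> b \<in> q" for a b
  proof (rule ccontr)
    assume "\<not> (a \<in> q \<or> b \<in> q)"
    with meets ab obtain m n where mn: "m \<in> M" "n \<in> M" "m \<in> gen (insert a q)" "n \<in> gen (insert b q)"
      by metis
    \<comment> \<open>By \<open>gen_mult\<close> only products of generators matter:
      \<open>a \<star> b\<close> is in \<open>q\<close> by assumption, and the others have a factor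
      in \<open>q\<close>. But \<open>m \<star> n\<close> also lies in \<open>M\<close>.\<close>
    have "m \<star> n \<in> q"
      by (rule gen_mult[OF q(1) _ _ _ mn(3,4)])
        (use ab ideal_subset[OF q(1)] ideal_mult[OF q(1)] ideal_mult'[OF q(1)] in auto)
    with Mmult mn q(3) show False by blast
  qed
  \<comment> \<open>Properness comes from the elements of the nonempty \<open>M\<close>, which
    \<open>q\<close> omits.\<close>
  moreover have "q \<noteq> carrier A" using q(3) M by auto
  ultimately have "q \<in> Primes" using q(1) by (auto simp: Spec_Id_lattice_iff)
  with q show ?thesis by auto
qed

section \<open>Basic open sets and their compactness\<close>

definition basic_open :: "'a \<Rightarrow> 'a set set" where
  "basic_open a = {p \<in> Primes. a \<notin> p}"

lemma basic_open_mult: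
  assumes "a \<in> carrier A" "b \<in> carrier A"
  shows "basic_open (a \<star> b) = basic_open a \<inter> basic_open b"
proof -
  have "a \<star> b \<in> p \<longleftrightarrow> a \<in> p \<or> b \<in> p" if "p \<in> Primes" for p
    using that assms ideal_mult[of p a b] ideal_mult'[of p b a] unfolding Spec_Id_lattice_iff by blast
  then show ?thesis by (auto simp: basic_open_def)
qed

lemma zariski_closed_Id_lattice: "zariski_closed (Id_lattice \<Sigma> A) x = {p \<in> Primes. x \<subseteq> p}"
  by (simp add: zariski_closed_def Id_lattice_def)

lemma topspace_Zariski: "topspace Zariski = Primes"
  by (rule complete_multiplicative_lattice.topspace_zariski[OF Id_lattice])

lemma gen_subset_prime_iff: "p \<in> Primes \<Longrightarrow> gen S \<subseteq> p \<longleftrightarrow> S \<subseteq> p"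
  using gen_least[of p S] subset_gen[of S] unfolding Spec_Id_lattice_iff by blast

text \<open>The complement of \<open>V(x)\<close> consists of the primes that omit some element of
  \<open>x\<close>.\<close>

lemma openin_Zariski_iff: "openin Zariski U \<longleftrightarrow> (\<exists>x. ideal x \<and> U = \<Union>(basic_open ` x))"
proof -
  have "Primes - zariski_closed (Id_lattice \<Sigma> A) x = \<Union>(basic_open ` x)" for x
    by (auto simp: zariski_closed_Id_lattice basic_open_def)
  then show ?thesis
    by (simp add: complete_multiplicative_lattice.openin_zariski[OF Id_lattice])
      (simp add: Id_lattice_def)
qed

lemma openin_basic_open:
  assumes "a \<in> carrier A"
  shows "openin Zariski (basic_open a)"
proof -
  \<comment> \<open>A prime omits some element of \<open>gen {a}\<close> exactly if it omits
    \<open>a\<close>.\<close>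
  have "basic_open a = \<Union>(basic_open ` gen {a})"
    using gen_subset_prime_iff[of _ "{a}"] by (auto simp: basic_open_def)
  then show ?thesis using ideal_gen[of "{a}"] assms openin_Zariski_iff by auto
qed

lemma closedin_Zariski_iff: "closedin Zariski C \<longleftrightarrow> (\<exists>x. ideal x \<and> C = {p \<in> Primes. x \<subseteq> p})"
  by (simp add: complete_multiplicative_lattice.closedin_zariski[OF Id_lattice] zariski_closed_Id_lattice)
    (simp add: Id_lattice_def)

lemma compactin_basic_open:
  assumes a: "a \<in> carrier A"
  shows "compactin Zariski (basic_open a)"
  unfolding compactin_def
proof (intro conjI allI impI)
  show "basic_open a \<subseteq> topspace Zariski" by (auto simp: topspace_Zariski basic_open_def)
next
  fix \<U> assume \<U>: "(\<forall>U\<in>\<U>. openin Zariski U) \<and> basic_open a \<subseteq> \<Union>\<U>"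
  \<comment> \<open>\<open>S\<close> collects the elements whose basic open set fits inside a single
    member of the cover, so finitely many of them give a finite subcover.\<close>
  define S where "S = {s \<in> carrier A. \<exists>U\<in>\<U>. basic_open s \<subseteq> U}"
  define M where "M = {m \<in> carrier A. basic_open a \<subseteq> basic_open m}"
  have S: "S \<subseteq> carrier A" by (auto simp: S_def)
  have "gen S \<inter> M \<noteq> {}"
  proof
    assume disj: "gen S \<inter> M = {}"
    have "a \<in> M" using a by (auto simp: M_def)
    have Mmult: "m \<star> n \<in> M" if "m \<in> M" "n \<in> M" for m n
      using that by (simp add: M_def mult_closed basic_open_mult)
    have "M \<subseteq> carrier A" "M \<noteq> {}" using \<open>a \<in> M\<close> by (auto simp: M_def)
    \<comment> \<open>Such a prime omits \<open>a\<close>, so the cover puts it into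
      \<open>basic_open s\<close> for some \<open>s \<in> S\<close>, although it contains
      \<open>S\<close>.\<close>
    from exists_prime_disjoint[OF ideal_gen[OF S] this Mmult disj]
    obtain p where p: "p \<in> Primes" "gen S \<subseteq> p" "p \<inter> M = {}" by auto
    have "a \<notin> p" using p(3) \<open>a \<in> M\<close> by blast
    with p(1) have "p \<in> basic_open a" by (simp add: basic_open_def)
    with \<U> obtain U where U: "U \<in> \<U>" "p \<in> U" by blast
    with \<U> obtain x where x: "ideal x" "U = \<Union>(basic_open ` x)"
      by (auto simp: openin_Zariski_iff)
    with U obtain s where "s \<in> x" "p \<in> basic_open s" by auto
    moreover have "s \<in> S" using x(2) U(1) \<open>s \<in> x\<close> ideal_subset[OF x(1)] by (auto simp: S_def)
    ultimately show False using p(2) subset_gen[of S] by (auto simp: basic_open_def)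
  qed
  then obtain m where m: "m \<in> gen S" "basic_open a \<subseteq> basic_open m" by (auto simp: M_def)
  with gen_finite[OF S] obtain F where F: "finite F" "F \<subseteq> S" "m \<in> gen F" by blast
  then have "\<forall>s\<in>F. \<exists>U\<in>\<U>. basic_open s \<subseteq> U" by (auto simp: S_def)
  then obtain u where u: "\<And>s. s \<in> F \<Longrightarrow> u s \<in> \<U> \<and> basic_open s \<subseteq> u s" by metis
  \<comment> \<open>A prime containing \<open>F\<close> contains \<open>gen F\<close> and therefore
    \<open>m\<close>.\<close>
  have "basic_open m \<subseteq> \<Union>(basic_open ` F)"
    using gen_subset_prime_iff[of _ F] F(3) by (auto simp: basic_open_def)
  also have "\<dots> \<subseteq> \<Union>(u ` F)" using u by (intro UN_mono) auto
  finally have "basic_open a \<subseteq> \<Union>(u ` F)" using m(2) by simp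
  then show "\<exists>\<F>. finite \<F> \<and> \<F> \<subseteq> \<U> \<and> basic_open a \<subseteq> \<Union>\<F>"
    using u F(1) by (meson finite_imageI image_subsetI)
qed

section \<open>Sobriety, compactness and the conclusion\<close>

lemma sober_Zariski: "sober_space Zariski"
  unfolding sober_space_def
proof (intro conjI allI impI)
  show "t0_space Zariski"
    unfolding t0_space_def
  proof (intro ballI impI)
    fix p q assume pq: "p \<in> topspace Zariski" "q \<in> topspace Zariski" "p \<noteq> q"
    from pq(1,2) have pr: "p \<in> Primes" "q \<in> Primes" by (simp_all add: topspace_Zariski)
    then have "p \<union> q \<subseteq> carrier A"
      using ideal_subset[of p] ideal_subset[of q] by (simp add: Spec_Id_lattice_iff)
    with pq(3) obtain a where a: "a \<in> carrier A" "a \<notin> p \<longleftrightarrow> a \<in> q" by blast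
    with pr have "p \<notin> basic_open a \<longleftrightarrow> q \<in> basic_open a" by (auto simp: basic_open_def)
    with openin_basic_open[OF a(1)] show "\<exists>U. openin Zariski U \<and> (p \<notin> U \<longleftrightarrow> q \<in> U)" by blast
  qed
next
  fix C assume C: "irreducible_closed Zariski C"
  then obtain x where x: "ideal x" "C = {p \<in> Primes. x \<subseteq> p}" and "C \<noteq> {}"
    by (auto simp: irreducible_closed_def closedin_Zariski_iff)
  have ideal_C: "ideal p" "p \<noteq> carrier A" "p \<subseteq> carrier A" if "p \<in> C" for p
    using x that ideal_subset by (auto simp: Spec_Id_lattice_iff)
  \<comment> \<open>\<open>P\<close> is the candidate generic point. It is proper because it lies
    inside a member of the nonempty set \<open>C\<close>, all of whose members are proper.\<close>
  define P where "P = carrier A \<inter> \<Inter>C"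
  have P: "ideal P"
    unfolding P_def using ideal_C by (intro alg_ideal_Inter[OF in_dot_variety]) auto
  have closed: "closedin Zariski (C - basic_open a)" if "a \<in> carrier A" for a
    using C openin_basic_open[OF that] by (auto simp: irreducible_closed_def intro: closedin_diff)
  have "a \<in> P \<or> b \<in> P" if ab: "a \<in> carrier A" "b \<in> carrier A" "a \<star> b \<in> P" for a b
  proof -
    \<comment> \<open>Every prime in \<open>C\<close> contains \<open>a \<star> b\<close>, so
      removing either basic open set from \<open>C\<close> leaves two closed sets that cover
      \<open>C\<close>. Irreducibility makes one of them all of \<open>C\<close>, which says that
      \<open>a\<close> or \<open>b\<close> lies in every member of \<open>C\<close>.\<close>
    have "basic_open a \<inter> basic_open b \<inter> C = {}"
      using ab basic_open_mult[of a b] by (auto simp: basic_open_def P_def)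
    then have "C = (C - basic_open a) \<union> (C - basic_open b)" by auto
    with C closed[OF ab(1)] closed[OF ab(2)] have "C = C - basic_open a \<or> C = C - basic_open b"
      unfolding irreducible_closed_def by blast
    then show ?thesis using ab x by (auto simp: P_def basic_open_def)
  qed
  moreover have "P \<noteq> carrier A" using \<open>C \<noteq> {}\<close> ideal_C unfolding P_def by blast
  ultimately have "P \<in> Primes" using P by (auto simp: Spec_Id_lattice_iff)
  moreover have "x \<subseteq> P" using x ideal_subset by (auto simp: P_def)
  ultimately have "P \<in> C" using x by simp
  have "Zariski closure_of {P} = C"
  proof (rule closure_of_unique)
    show "closedin Zariski C" using C by (auto simp: irreducible_closed_def)
  next
    fix T assume "{P} \<subseteq> T" "closedin Zariski T"
    \<comment> \<open>A closed set containing \<open>P\<close> is some \<open>V(y)\<close> with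
      \<open>y \<subseteq> P\<close>, and \<open>P\<close> lies below every member of
      \<open>C\<close>.\<close>
    then obtain y where "T = {p \<in> Primes. y \<subseteq> p}" "y \<subseteq> P" by (auto simp: closedin_Zariski_iff)
    then show "C \<subseteq> T" using x by (auto simp: P_def)
  qed (use \<open>P \<in> C\<close> in auto)
  then show "\<exists>p\<in>topspace Zariski. C = Zariski closure_of {p}"
    using \<open>P \<in> Primes\<close> by (auto simp: topspace_Zariski)
qed

text \<open>A prime containing a set that generates \<open>A\<close> as an ideal would be all of
  \<open>A\<close>. Hence the basic open sets of finitely many generators cover the spectrum, and
  each of them is compact.\<close>

lemma compact_Zariski:
  assumes "fin_gen_ideal_of_itself \<Sigma> A"
  shows "compact_space Zariski"
proof -
  obtain S where S: "finite S" "S \<subseteq> carrier A" "gen S = carrier A"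
    using assms by (auto simp: fin_gen_ideal_of_itself_def)
  have "topspace Zariski = \<Union>(basic_open ` S)"
  proof -
    have "\<not> S \<subseteq> p" if "p \<in> Primes" for p
      using gen_subset_prime_iff[OF that, of S] S(3) that ideal_subset[of p]
      by (auto simp: Spec_Id_lattice_iff)
    then show ?thesis by (auto simp: topspace_Zariski basic_open_def)
  qed
  moreover have "compactin Zariski (\<Union>(basic_open ` S))"
    using S compactin_basic_open by (intro compactin_Union) auto
  ultimately show ?thesis by (simp add: compact_space_def)
qed

theorem spectral_Zariski:
  assumes "fin_gen_ideal_of_itself \<Sigma> A"
  shows "spectral_space Zariski"
proof (rule spectral_spaceI[OF compact_Zariski[OF assms] sober_Zariski,
      where \<B> = "basic_open ` carrier A"])
  show "compact_open Zariski U" if "U \<in> basic_open ` carrier A" for U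
    using that openin_basic_open compactin_basic_open by (auto simp: compact_open_def)
  show "U \<inter> V \<in> basic_open ` carrier A"
    if "U \<in> basic_open ` carrier A" "V \<in> basic_open ` carrier A" for U V
    using that by (auto simp: mult_closed simp flip: basic_open_mult)
  show "\<exists>\<U>\<subseteq>basic_open ` carrier A. U = \<Union>\<U>" if "openin Zariski U" for U
    using that ideal_subset by (metis image_mono openin_Zariski_iff)
qed

end

theorem theorem11p5:
  fixes \<Sigma> :: "'f signature"
    and E :: "('f trm \<times> 'f trm) set"
    and A :: "('f, 'a) dot_alg"
  assumes "E \<subseteq> identities \<Sigma>"
    and "in_dot_variety \<Sigma> E A"
    and "fin_gen_ideal_of_itself \<Sigma> A"
  shows "spectral_space (zariski_topology (Id_lattice \<Sigma> A))"
proof -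
  interpret dot_algebra \<Sigma> E A by (rule dot_algebra.intro[OF assms(2)])
  show ?thesis by (rule spectral_Zariski[OF assms(3)])
qed

end
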